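(* The rational divisor graph $Q[1,7]$ is planar and $3$-colorable.
   Context: For a subset $S\subseteq\mathbb{Q}$, the rational divisor graph $Q(S)$ is the simple graph with vertex set $S$ in which $u,v\in S$ are adjacent if and only if $u\neq v$ and either $u=nv$ or $v=nu$ for some $n\in\mathbb{N}=\{1,2,3,\ldots\}$. $Q[1,7]$ denotes $Q([1,7]\cap\mathbb{Q})$, a countably infinite graph. A graph is planar if it can be drawn in the plane without edge crossings, and $3$-colorable if its vertices can be colored with at most $3$ colors so that adjacent vertices receive different colors. *)

theory Defs
  imports "HOL-Analysis.Analysis"
begin

text \<open>A simple graph is a vertex set together with a set of edges, each edge being
  a set of two distinct vertices.\<close>

type_synonym 'a sgraph = "'a set \<times> 'a set set"

abbreviation verts :: "'a sgraph \<Rightarrow> 'a set" where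
  "verts G \<equiv> fst G"

abbreviation edges :: "'a sgraph \<Rightarrow> 'a set set" where
  "edges G \<equiv> snd G"

definition rat_div_adjacent :: "rat \<Rightarrow> rat \<Rightarrow> bool" where
  "rat_div_adjacent u v \<longleftrightarrow>
     u \<noteq> v \<and> (\<exists>n::nat. n \<ge> 1 \<and> (u = of_nat n * v \<or> v = of_nat n * u))"

definition rat_div_graph :: "rat set \<Rightarrow> rat sgraph" where
  "rat_div_graph S = (S, {{u, v} | u v. u \<in> S \<and> v \<in> S \<and> rat_div_adjacent u v})"

text \<open>The plane is modelled by \<^typ>\<open>complex\<close>. Vertex \<open>v\<close> is drawn as the point \<open>p v\<close>, and
  edge \<open>e\<close> as the simple arc \<open>\<gamma> e\<close> joining the points of its two ends. An arc contains no
  vertex points besides its ends, and two different arcs meet at most in the point of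
  a common end. The graph may be infinite; the drawn points and arcs are allowed to
  accumulate in the plane.\<close>

definition plane_drawing ::
  "'a sgraph \<Rightarrow> ('a \<Rightarrow> complex) \<Rightarrow> ('a set \<Rightarrow> real \<Rightarrow> complex) \<Rightarrow> bool" where
  "plane_drawing G p \<gamma> \<longleftrightarrow>
     inj_on p (verts G) \<and>
     (\<forall>e\<in>edges G. arc (\<gamma> e) \<and> {pathstart (\<gamma> e), pathfinish (\<gamma> e)} = p ` e) \<and>
     (\<forall>e\<in>edges G. path_image (\<gamma> e) \<inter> p ` verts G = p ` e) \<and>
     (\<forall>e\<in>edges G. \<forall>f\<in>edges G. e \<noteq> f \<longrightarrow>
        path_image (\<gamma> e) \<inter> path_image (\<gamma> f) = p ` (e \<inter> f))"

definition planar :: "'a sgraph \<Rightarrow> bool" where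
  "planar G \<longleftrightarrow> (\<exists>p \<gamma>. plane_drawing G p \<gamma>)"

definition colorable :: "nat \<Rightarrow> 'a sgraph \<Rightarrow> bool" where
  "colorable k G \<longleftrightarrow>
     (\<exists>c :: 'a \<Rightarrow> nat. c ` verts G \<subseteq> {..<k} \<and>
        (\<forall>u\<in>verts G. \<forall>v\<in>verts G. {u, v} \<in> edges G \<longrightarrow> c u \<noteq> c v))"

end

theory Submission
  imports Defs
begin

text \<open>
  An edge joins some \<open>u\<close> to \<open>n * u\<close> with \<open>2 \<le> n \<le> 7\<close>. Such a step always leaves the interval
  \<open>[1,2)\<close>, \<open>[2,4)\<close> or \<open>[4,7]\<close> that contains \<open>u\<close>, because \<open>n\<close> is at least \<open>2\<close>; colouring a vertex by
  its interval is therefore proper.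

  For planarity, sort the vertices into cosets of the multiplicative group generated by \<open>2\<close>, \<open>3\<close>
  and \<open>5\<close>. The coset of \<open>q\<close> is named by \<open>core q\<close>, which is \<open>q\<close> stripped of its powers of \<open>2\<close>, \<open>3\<close>
  and \<open>5\<close>. Multiplication by \<open>7\<close> is possible only at \<open>u = 1\<close>, so every edge except \<open>{1, 7}\<close> stays in
  one coset.

  Inside a coset, the exponents \<open>a\<close> of \<open>3\<close> and \<open>b\<close> of \<open>5\<close> determine a vertex up to a power of \<open>2\<close>, so
  that each pair \<open>(a, b)\<close> belongs to at most three vertices: one in each of the three
  intervals. Draw them near the point \<open>(a, b)\<close> of an integer lattice. Multiplication by \<open>2\<close> and \<open>4\<close>
  then stays near the lattice point, by \<open>3\<close> and \<open>6\<close> goes to its right neighbour, by \<open>5\<close> to its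
  upper neighbour. The size restrictions leave so few of these edges that they can all be drawn as
  straight segments without crossings. The only delicate vertex is the one in
  \<open>[2,4)\<close>: it must sit on the right of its lattice point if it is at most \<open>7/3\<close>, since then its triple
  is a vertex, and on the left otherwise, since then it may itself be the triple of a vertex. The
  resulting segments, called struts below, belong to one periodic pattern whose tile
  consists of nine segments, which reduces the absence of crossings to finitely many linear
  problems (\<open>struts_disjoint\<close>, \<open>strut_avoids_nodes\<close>, \<open>divisor_edge_strut\<close>).

  The cosets of \<open>1\<close> and \<open>7\<close> are linked by the edge \<open>{1, 7}\<close>. In the drawing of the first, an open disc
  that misses the whole drawing has the point of \<open>1\<close> on its boundary, and likewise for \<open>7\<close> in the second. An inversion in
  the second disc turns that drawing inside out, so that it fits into the first disc with the
  point of \<open>7\<close> facing the point of \<open>1\<close> (\<open>planar_bridge\<close>). Finally there are only countably many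
  cosets, and each drawing can be shrunk into a disc of its own (\<open>planar_disjoint_union\<close>).
\<close>

section \<open>Operations on plane drawings\<close>

definition drawing_points ::
  "'a sgraph \<Rightarrow> ('a \<Rightarrow> complex) \<Rightarrow> ('a set \<Rightarrow> real \<Rightarrow> complex) \<Rightarrow> complex set" where
  "drawing_points G p \<gamma> = p ` verts G \<union> (\<Union>e\<in>edges G. path_image (\<gamma> e))"

lemma plane_drawing_edge_nonempty:
  assumes "plane_drawing G p \<gamma>" "e \<in> edges G"
  shows "e \<noteq> {}"
  using assms by (auto simp: plane_drawing_def)

text \<open>A closed segment is its open part together with its two ends, so for straight edges all
  conditions on a drawing reduce to the open segments: they contain no vertex and are disjoint.
  The functions \<open>s\<close> and \<open>t\<close> choose an orientation of each edge.\<close>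

lemma plane_drawing_straight:
  fixes p :: "'a \<Rightarrow> complex"
  assumes inj: "inj_on p V"
    and ends: "\<And>e. e \<in> E \<Longrightarrow> e = {s e, t e} \<and> s e \<noteq> t e \<and> s e \<in> V \<and> t e \<in> V"
    and nodes: "\<And>e w. e \<in> E \<Longrightarrow> w \<in> V \<Longrightarrow> p w \<notin> open_segment (p (s e)) (p (t e))"
    and disj: "\<And>e f. e \<in> E \<Longrightarrow> f \<in> E \<Longrightarrow> e \<noteq> f \<Longrightarrow>
      open_segment (p (s e)) (p (t e)) \<inter> open_segment (p (s f)) (p (t f)) = {}"
  shows "plane_drawing (V, E) p (\<lambda>e. linepath (p (s e)) (p (t e)))"
proof -
  have ne: "p (s e) \<noteq> p (t e)" if "e \<in> E" for e
    using ends[OF that] inj by (metis inj_onD)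
  have sub: "e \<subseteq> V" if "e \<in> E" for e
    using ends[OF that] by (metis empty_subsetI insert_subset)
  have pe: "p ` e = {p (s e), p (t e)}" if "e \<in> E" for e
  proof -
    have "e = {s e, t e}" using ends[OF that] by blast
    then show ?thesis by (metis image_empty image_insert)
  qed
  have im: "closed_segment (p (s e)) (p (t e)) = open_segment (p (s e)) (p (t e)) \<union> p ` e"
    if "e \<in> E" for e
    unfolding pe[OF that] by (rule closed_segment_eq_open)
  have vert: "closed_segment (p (s e)) (p (t e)) \<inter> p ` V = p ` e" if "e \<in> E" for e
    using im[OF that] nodes[OF that] sub[OF that] by auto
  have "closed_segment (p (s e)) (p (t e)) \<inter> closed_segment (p (s f)) (p (t f)) = p ` (e \<inter> f)"
    if "e \<in> E" "f \<in> E" "e \<noteq> f" for e f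
  proof -
    have sets: "A \<inter> B = X \<inter> Y"
      if "A = I \<union> X" "B = J \<union> Y" "A \<inter> P = X" "B \<inter> P = Y" "I \<inter> J = {}"
      for A B I J P X Y :: "complex set"
      using that by blast
    have "closed_segment (p (s e)) (p (t e)) \<inter> closed_segment (p (s f)) (p (t f)) = p ` e \<inter> p ` f"
      by (rule sets[OF im[OF that(1)] im[OF that(2)] vert[OF that(1)] vert[OF that(2)] disj[OF that]])
    also have "\<dots> = p ` (e \<inter> f)"
      using inj_on_image_Int[OF inj sub[OF that(1)] sub[OF that(2)]] by simp
    finally show ?thesis .
  qed
  with inj ne vert pe show ?thesis
    by (simp add: plane_drawing_def arc_linepath)
qed

text \<open>Only the drawn points matter for continuity and injectivity, so the lemma also covers maps such
  as inversions, which are undefined somewhere in the plane.\<close>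

lemma plane_drawing_transport:
  assumes draw: "plane_drawing G p \<gamma>"
    and sub: "\<And>e. e \<in> edges G \<Longrightarrow> e \<subseteq> verts G"
    and cont: "continuous_on (drawing_points G p \<gamma>) \<phi>"
    and inj: "inj_on \<phi> (drawing_points G p \<gamma>)"
  shows "plane_drawing G (\<phi> \<circ> p) (\<lambda>e. \<phi> \<circ> \<gamma> e)"
    and "drawing_points G (\<phi> \<circ> p) (\<lambda>e. \<phi> \<circ> \<gamma> e) = \<phi> ` drawing_points G p \<gamma>"
proof -
  let ?D = "drawing_points G p \<gamma>"
  have PD: "p ` verts G \<subseteq> ?D" and ED: "\<And>e. e \<in> edges G \<Longrightarrow> path_image (\<gamma> e) \<subseteq> ?D"
    by (auto simp: drawing_points_def)
  have "inj_on (\<phi> \<circ> p) (verts G)"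
    using draw inj PD by (auto simp: plane_drawing_def intro: comp_inj_on inj_on_subset)
  moreover have "arc (\<phi> \<circ> \<gamma> e)" if "e \<in> edges G" for e
  proof -
    have "path (\<phi> \<circ> \<gamma> e)"
      using draw that ED[OF that] cont
      by (intro path_continuous_image) (auto simp: plane_drawing_def arc_def intro: continuous_on_subset)
    moreover have "inj_on (\<phi> \<circ> \<gamma> e) {0..1}"
      using draw that ED[OF that] inj
      by (intro comp_inj_on) (auto simp: plane_drawing_def arc_def path_image_def intro: inj_on_subset)
    ultimately show ?thesis by (simp add: arc_def)
  qed
  moreover have "{pathstart (\<phi> \<circ> \<gamma> e), pathfinish (\<phi> \<circ> \<gamma> e)} = (\<phi> \<circ> p) ` e"
    if "e \<in> edges G" for e
  proof -
    have "{pathstart (\<gamma> e), pathfinish (\<gamma> e)} = p ` e"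
      using draw that by (simp add: plane_drawing_def)
    then show ?thesis
      by (metis image_comp image_empty image_insert pathfinish_compose pathstart_compose)
  qed
  moreover have "path_image (\<phi> \<circ> \<gamma> e) \<inter> (\<phi> \<circ> p) ` verts G = (\<phi> \<circ> p) ` e"
    if "e \<in> edges G" for e
  proof -
    have "path_image (\<gamma> e) \<inter> p ` verts G = p ` e"
      using draw that by (simp add: plane_drawing_def)
    then show ?thesis
      using inj_on_image_Int[OF inj ED[OF that] PD] by (simp add: path_image_compose image_comp)
  qed
  moreover have "path_image (\<phi> \<circ> \<gamma> e) \<inter> path_image (\<phi> \<circ> \<gamma> f) = (\<phi> \<circ> p) ` (e \<inter> f)"
    if "e \<in> edges G" "f \<in> edges G" "e \<noteq> f" for e f
  proof -
    have "path_image (\<gamma> e) \<inter> path_image (\<gamma> f) = p ` (e \<inter> f)"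
      using draw that by (simp add: plane_drawing_def)
    then show ?thesis
      using inj_on_image_Int[OF inj ED[OF that(1)] ED[OF that(2)]]
      by (simp add: path_image_compose image_comp)
  qed
  ultimately show "plane_drawing G (\<phi> \<circ> p) (\<lambda>e. \<phi> \<circ> \<gamma> e)"
    unfolding plane_drawing_def by blast
  show "drawing_points G (\<phi> \<circ> p) (\<lambda>e. \<phi> \<circ> \<gamma> e) = \<phi> ` ?D"
    by (simp add: drawing_points_def path_image_compose image_Un image_UN image_comp)
qed

definition fibre :: "('a \<Rightarrow> 'b) \<Rightarrow> 'a sgraph \<Rightarrow> 'b \<Rightarrow> 'a sgraph" where
  "fibre f G i = ({v \<in> verts G. f v = i}, {e \<in> edges G. f ` e = {i}})"

text \<open>Drawings of the fibres combine as soon as they live in disjoint regions \<open>D i\<close>: inside a region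
  the given drawing takes care of all intersections, and across regions there are none.
  The index of an edge is read off as the only element of its image under \<open>f\<close>.\<close>

lemma plane_drawing_glue:
  fixes f :: "'a \<Rightarrow> 'b"
  assumes sub: "\<And>e. e \<in> edges G \<Longrightarrow> e \<subseteq> verts G"
    and const: "\<And>e. e \<in> edges G \<Longrightarrow> \<exists>i. f ` e = {i}"
    and draw: "\<And>i. plane_drawing (fibre f G i) (p i) (\<gamma> i)"
    and region: "\<And>i. drawing_points (fibre f G i) (p i) (\<gamma> i) \<subseteq> D i"
    and disj: "\<And>i j. i \<noteq> j \<Longrightarrow> D i \<inter> D j = {}"
  defines "q \<equiv> \<lambda>v. p (f v) v" and "\<delta> \<equiv> \<lambda>e. \<gamma> (the_elem (f ` e)) e"
  shows "plane_drawing G q \<delta>"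
    and "drawing_points G q \<delta> = (\<Union>i. drawing_points (fibre f G i) (p i) (\<gamma> i))"
proof -
  let ?V = "\<lambda>i. {v \<in> verts G. f v = i}" and ?E = "\<lambda>i. {e \<in> edges G. f ` e = {i}}"
  have qV: "q ` ?V i = p i ` ?V i" for i
    by (auto simp: q_def)
  have qe: "q ` e = p i ` e" "\<delta> e = \<gamma> i e" "e \<subseteq> ?V i" if "e \<in> ?E i" for e i
    using that sub[of e] by (auto simp: q_def \<delta>_def)
  have pV: "p i ` ?V i \<subseteq> D i" for i
    using region[of i] by (auto simp: drawing_points_def fibre_def)
  have pE: "path_image (\<gamma> i e) \<subseteq> D i" if "e \<in> ?E i" for i e
  proof -
    have "path_image (\<gamma> i e) \<subseteq> drawing_points (fibre f G i) (p i) (\<gamma> i)"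
      using that unfolding drawing_points_def fibre_def snd_conv by blast
    then show ?thesis using region[of i] by blast
  qed
  have d: "inj_on (p i) (?V i)"
    "\<And>e. e \<in> ?E i \<Longrightarrow> arc (\<gamma> i e) \<and> {pathstart (\<gamma> i e), pathfinish (\<gamma> i e)} = p i ` e"
    "\<And>e. e \<in> ?E i \<Longrightarrow> path_image (\<gamma> i e) \<inter> p i ` ?V i = p i ` e"
    "\<And>e e'. e \<in> ?E i \<Longrightarrow> e' \<in> ?E i \<Longrightarrow> e \<noteq> e' \<Longrightarrow>
       path_image (\<gamma> i e) \<inter> path_image (\<gamma> i e') = p i ` (e \<inter> e')" for i
    using draw[of i] by (simp_all add: plane_drawing_def fibre_def)
  have inj: "inj_on q (verts G)"
  proof (rule inj_onI)
    fix u v assume uv: "u \<in> verts G" "v \<in> verts G" "q u = q v"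
    have "q u \<in> D (f u)" "q v \<in> D (f v)"
      using pV[of "f u"] pV[of "f v"] uv by (auto simp: q_def)
    then have "f u = f v"
      using disj[of "f u" "f v"] uv(3) by auto
    then show "u = v"
      using uv d(1)[of "f u"] by (auto simp: q_def dest: inj_onD)
  qed
  have idx: "\<exists>i. e \<in> ?E i" if "e \<in> edges G" for e
    using const[OF that] that by auto
  have "path_image (\<delta> e) \<inter> q ` verts G = q ` e" if "e \<in> edges G" for e
  proof -
    from idx[OF that] obtain i where i: "e \<in> ?E i" by blast
    have "path_image (\<delta> e) \<inter> q ` verts G = path_image (\<gamma> i e) \<inter> p i ` ?V i"
    proof -
      have "f v = i" if "v \<in> verts G" "q v \<in> path_image (\<gamma> i e)" for v
      proof (rule ccontr)
        assume "f v \<noteq> i"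
        moreover have "q v \<in> D (f v)" using pV[of "f v"] that by (auto simp: q_def)
        ultimately show False using disj pE[OF i] that by blast
      qed
      then show ?thesis unfolding qe(2)[OF i] using qV[of i] by blast
    qed
    then show ?thesis using d(3)[OF i] qe(1)[OF i] by simp
  qed
  moreover have "path_image (\<delta> e) \<inter> path_image (\<delta> e') = q ` (e \<inter> e')"
    if "e \<in> edges G" "e' \<in> edges G" "e \<noteq> e'" for e e'
  proof -
    from idx[OF that(1)] idx[OF that(2)]
    obtain i j where i: "e \<in> ?E i" and j: "e' \<in> ?E j" by blast
    show ?thesis
    proof (cases "i = j")
      case True
      have "q ` (e \<inter> e') = p i ` (e \<inter> e')"
        using qe(3)[OF i] by (auto simp: q_def)
      with True show ?thesis
        using d(4)[OF i] j that(3) qe(2)[OF i] qe(2)[OF j] by simp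
    next
      case False
      have "e \<inter> e' = {}" using False qe(3)[OF i] qe(3)[OF j] by blast
      moreover have "path_image (\<delta> e) \<inter> path_image (\<delta> e') = {}"
        using disj[OF False] pE[OF i] pE[OF j] qe(2)[OF i] qe(2)[OF j] by auto
      ultimately show ?thesis by simp
    qed
  qed
  moreover have "arc (\<delta> e) \<and> {pathstart (\<delta> e), pathfinish (\<delta> e)} = q ` e" if "e \<in> edges G" for e
  proof -
    from idx[OF that] obtain i where i: "e \<in> ?E i" by blast
    show ?thesis using d(2)[OF i] unfolding qe(1)[OF i] qe(2)[OF i] .
  qed
  ultimately show "plane_drawing G q \<delta>"
    using inj by (simp add: plane_drawing_def)
  have "(\<Union>e\<in>edges G. path_image (\<delta> e)) = (\<Union>i. \<Union>e\<in>?E i. path_image (\<gamma> i e))"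
  proof -
    have "edges G = (\<Union>i. ?E i)"
    proof (intro equalityI subsetI)
      fix e assume "e \<in> edges G"
      then show "e \<in> (\<Union>i. ?E i)"
        using idx[of e] by (simp only: UN_iff) blast
    qed blast
    then have "(\<Union>e\<in>edges G. path_image (\<delta> e)) = (\<Union>i. \<Union>e\<in>?E i. path_image (\<delta> e))"
      by (metis UN_UN_flatten)
    also have "\<dots> = (\<Union>i. \<Union>e\<in>?E i. path_image (\<gamma> i e))"
      by (intro SUP_cong refl arg_cong[where f = path_image] qe(2))
    finally show ?thesis .
  qed
  moreover have "q ` verts G = (\<Union>i. p i ` ?V i)"
    by (auto simp: q_def)
  ultimately show "drawing_points G q \<delta> = (\<Union>i. drawing_points (fibre f G i) (p i) (\<gamma> i))"
    by (simp only: drawing_points_def fibre_def fst_conv snd_conv UN_Un_distrib)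
qed

lemma plane_drawing_add_edge:
  assumes draw: "plane_drawing (V, E) p \<gamma>"
    and sub: "\<And>e. e \<in> E \<Longrightarrow> e \<subseteq> V"
    and uv: "u \<in> V" "v \<in> V"
    and g: "arc g" "pathstart g = p u" "pathfinish g = p v"
    and free: "path_image g \<inter> drawing_points (V, E) p \<gamma> \<subseteq> {p u, p v}"
  shows "plane_drawing (V, insert {u, v} E) p (\<gamma>({u, v} := g))"
proof -
  have inj: "inj_on p V"
    and d: "\<And>e. e \<in> E \<Longrightarrow> path_image (\<gamma> e) \<inter> p ` V = p ` e"
    using draw by (auto simp: plane_drawing_def)
  have ends: "{p u, p v} \<subseteq> path_image g"
    using pathstart_in_path_image[of g] pathfinish_in_path_image[of g] g by auto
  have V: "path_image g \<inter> p ` V = {p u, p v}"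
    using free ends uv by (auto simp: drawing_points_def)
  have E: "path_image g \<inter> path_image (\<gamma> e) = p ` ({u, v} \<inter> e)" if "e \<in> E" for e
  proof -
    have "path_image g \<inter> path_image (\<gamma> e) = {p u, p v} \<inter> path_image (\<gamma> e)"
      using free ends that by (fastforce simp: drawing_points_def)
    also have "\<dots> = {p u, p v} \<inter> p ` e"
      using d[OF that] uv by blast
    also have "\<dots> = p ` ({u, v} \<inter> e)"
      using inj_on_image_Int[OF inj, of "{u, v}" e] uv sub[OF that] by simp
    finally show ?thesis .
  qed
  then have E': "path_image (\<gamma> e) \<inter> path_image g = p ` (e \<inter> {u, v})" if "e \<in> E" for e
    using that by (simp add: Int_commute)
  show ?thesis
    unfolding plane_drawing_def fst_conv snd_conv
  proof (intro conjI ballI impI inj)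
    fix e assume e: "e \<in> insert {u, v} E"
    show "arc ((\<gamma>({u, v} := g)) e)"
      and "{pathstart ((\<gamma>({u, v} := g)) e), pathfinish ((\<gamma>({u, v} := g)) e)} = p ` e"
      and "path_image ((\<gamma>({u, v} := g)) e) \<inter> p ` V = p ` e"
      using e draw g V by (cases "e = {u, v}"; simp add: plane_drawing_def)+
    fix f assume f: "f \<in> insert {u, v} E" "e \<noteq> f"
    show "path_image ((\<gamma>({u, v} := g)) e) \<inter> path_image ((\<gamma>({u, v} := g)) f) = p ` (e \<inter> f)"
    proof (cases "e = {u, v} \<or> f = {u, v}")
      case True
      then show ?thesis
      proof
        assume "e = {u, v}"
        then show ?thesis using E[of f] f by auto
      next
        assume "f = {u, v}"
        then show ?thesis using E'[of e] e f by auto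
      qed
    next
      case False
      then show ?thesis
        using e f draw by (simp add: plane_drawing_def)
    qed
  qed
qed

lemma squash_inj: "inj (\<lambda>z::complex. z /\<^sub>R (1 + norm z))"
proof (rule injI)
  fix z w :: complex
  assume eq: "z /\<^sub>R (1 + norm z) = w /\<^sub>R (1 + norm w)"
  have pos: "1 + norm z > 0" "1 + norm w > 0"
    by (simp_all add: add_pos_nonneg)
  have "norm (z /\<^sub>R (1 + norm z)) = norm (w /\<^sub>R (1 + norm w))"
    using eq by simp
  then have "norm z / (1 + norm z) = norm w / (1 + norm w)"
    using pos by (simp add: divide_inverse mult.commute)
  then have "norm z = norm w"
    using pos by (simp add: field_simps)
  with eq pos show "z = w" by simp
qed

text \<open>The map \<open>z \<mapsto> z / (1 + \<bar>z\<bar>)\<close> shrinks the plane into the open unit disc. Composed with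
  translations it moves the countably many fibre drawings into the discs of radius \<open>1\<close> about
  the points \<open>0, 2, 4, \<dots>\<close>.\<close>

lemma planar_disjoint_union:
  fixes f :: "'a \<Rightarrow> 'b"
  assumes sub: "\<And>e. e \<in> edges G \<Longrightarrow> e \<subseteq> verts G"
    and const: "\<And>e. e \<in> edges G \<Longrightarrow> \<exists>i. f ` e = {i}"
    and count: "countable (f ` verts G)"
    and planar: "\<And>i. planar (fibre f G i)"
  shows "planar G"
proof -
  define n where "n = to_nat_on (f ` verts G)"
  define \<phi> where "\<phi> = (\<lambda>i (z::complex). complex_of_real (2 * real (n i)) + z /\<^sub>R (1 + norm z))"
  define D where "D = (\<lambda>i. if i \<in> f ` verts G then ball (complex_of_real (2 * real (n i))) 1 else {})"
  from planar obtain p \<gamma> where draw: "\<And>i. plane_drawing (fibre f G i) (p i) (\<gamma> i)"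
    unfolding planar_def by metis
  have fsub: "e \<subseteq> verts (fibre f G i)" if "e \<in> edges (fibre f G i)" for e i
    using that sub[of e] by (auto simp: fibre_def)
  have cont: "continuous_on A (\<phi> i)" for A i
  proof -
    have "1 + norm (z::complex) \<noteq> 0" for z
      using norm_ge_zero[of z] by linarith
    then show ?thesis
      unfolding \<phi>_def by (intro continuous_intros) auto
  qed
  have inj: "inj_on (\<phi> i) A" for A i
    using inj_on_subset[OF squash_inj, of A] by (auto simp: \<phi>_def inj_on_def)
  note tr = plane_drawing_transport[OF draw fsub cont inj]
  have range: "\<phi> i z \<in> ball (complex_of_real (2 * real (n i))) 1" for i z
  proof -
    have "norm z / (1 + norm z) < 1"
      using norm_ge_zero[of z] by (subst divide_less_eq_1_pos) linarith+
    then show ?thesis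
      by (simp add: \<phi>_def dist_norm divide_inverse mult.commute)
  qed
  have region: "drawing_points (fibre f G i) (\<phi> i \<circ> p i) (\<lambda>e. \<phi> i \<circ> \<gamma> i e) \<subseteq> D i" for i
  proof (cases "i \<in> f ` verts G")
    case True
    have "drawing_points (fibre f G i) (\<phi> i \<circ> p i) (\<lambda>e. \<phi> i \<circ> \<gamma> i e)
        = \<phi> i ` drawing_points (fibre f G i) (p i) (\<gamma> i)"
      by (rule tr(2))
    then show ?thesis using True range by (auto simp: D_def)
  next
    case False
    then have "verts (fibre f G i) = {}" by (auto simp: fibre_def)
    moreover have "edges (fibre f G i) = {}"
    proof -
      have "f ` e \<noteq> {i}" if "e \<in> edges G" for e
        using False sub[OF that] by blast
      then show ?thesis by (simp add: fibre_def)
    qed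
    ultimately show ?thesis by (simp add: drawing_points_def)
  qed
  have disj: "D i \<inter> D j = {}" if "i \<noteq> j" for i j
  proof (cases "i \<in> f ` verts G \<and> j \<in> f ` verts G")
    case True
    then have "n i \<noteq> n j"
      using that inj_on_to_nat_on[OF count] unfolding n_def by (meson inj_onD)
    then have "1 \<le> \<bar>real (n i) - real (n j)\<bar>" by linarith
    then have "2 \<le> dist (complex_of_real (2 * real (n i))) (complex_of_real (2 * real (n j)))"
      by (simp only: dist_of_real dist_real_def)
    then show ?thesis
      using True by (simp add: D_def disjoint_ballI)
  qed (auto simp: D_def)
  show ?thesis
    unfolding planar_def
    using plane_drawing_glue(1)[OF sub const tr(1) region disj] by blast
qed

text \<open>Two drawings can be linked by an edge between \<open>v\<^sub>1\<close> and \<open>v\<^sub>2\<close> if each \<open>v\<^sub>i\<close> lies on the boundary of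
  a disc about \<open>c\<^sub>i\<close> whose interior misses the drawing. A similarity moves the first drawing outside the
  unit disc with \<open>v\<^sub>1\<close> at the point \<open>1\<close>; an inversion about \<open>c\<^sub>2\<close> moves the second one into the disc
  of radius \<open>1/2\<close> with \<open>v\<^sub>2\<close> at the point \<open>1/2\<close>. The segment from \<open>1\<close> to \<open>1/2\<close> crosses the annulus
  between them, where nothing else is drawn.\<close>

lemma planar_bridge:
  assumes d1: "plane_drawing (V\<^sub>1, E\<^sub>1) p\<^sub>1 \<gamma>\<^sub>1" and d2: "plane_drawing (V\<^sub>2, E\<^sub>2) p\<^sub>2 \<gamma>\<^sub>2"
    and s1: "\<And>e. e \<in> E\<^sub>1 \<Longrightarrow> e \<subseteq> V\<^sub>1" and s2: "\<And>e. e \<in> E\<^sub>2 \<Longrightarrow> e \<subseteq> V\<^sub>2"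
    and disj: "V\<^sub>1 \<inter> V\<^sub>2 = {}"
    and v: "v\<^sub>1 \<in> V\<^sub>1" "v\<^sub>2 \<in> V\<^sub>2"
    and c1: "p\<^sub>1 v\<^sub>1 \<noteq> c\<^sub>1" "\<And>z. z \<in> drawing_points (V\<^sub>1, E\<^sub>1) p\<^sub>1 \<gamma>\<^sub>1 \<Longrightarrow> dist c\<^sub>1 (p\<^sub>1 v\<^sub>1) \<le> dist c\<^sub>1 z"
    and c2: "p\<^sub>2 v\<^sub>2 \<noteq> c\<^sub>2" "\<And>z. z \<in> drawing_points (V\<^sub>2, E\<^sub>2) p\<^sub>2 \<gamma>\<^sub>2 \<Longrightarrow> dist c\<^sub>2 (p\<^sub>2 v\<^sub>2) \<le> dist c\<^sub>2 z"
  shows "planar (V\<^sub>1 \<union> V\<^sub>2, insert {v\<^sub>1, v\<^sub>2} (E\<^sub>1 \<union> E\<^sub>2))"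
proof -
  define G where "G = (V\<^sub>1 \<union> V\<^sub>2, E\<^sub>1 \<union> E\<^sub>2)"
  define f where "f = (\<lambda>v. v \<in> V\<^sub>1)"
  define \<phi>\<^sub>1 where "\<phi>\<^sub>1 = (\<lambda>z. (z - c\<^sub>1) / (p\<^sub>1 v\<^sub>1 - c\<^sub>1))"
  define \<phi>\<^sub>2 where "\<phi>\<^sub>2 = (\<lambda>z. (p\<^sub>2 v\<^sub>2 - c\<^sub>2) / (2 * (z - c\<^sub>2)))"
  define p where "p = (\<lambda>i. if i then \<phi>\<^sub>1 \<circ> p\<^sub>1 else \<phi>\<^sub>2 \<circ> p\<^sub>2)"
  define \<gamma> where "\<gamma> = (\<lambda>i e. if i then \<phi>\<^sub>1 \<circ> \<gamma>\<^sub>1 e else \<phi>\<^sub>2 \<circ> \<gamma>\<^sub>2 e)"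
  define D where "D = (\<lambda>i. if i then {z::complex. 1 \<le> norm z} else {z. norm z \<le> 1 / 2})"
  have fE: "f ` e = {True}" if "e \<in> E\<^sub>1" for e
  proof -
    have "f ` e = (\<lambda>_. True) ` e"
      using s1[OF that] by (intro image_cong) (auto simp: f_def)
    then show ?thesis
      using plane_drawing_edge_nonempty[OF d1, of e] that by (simp add: image_constant_conv)
  qed
  have fE': "f ` e = {False}" if "e \<in> E\<^sub>2" for e
  proof -
    have "f ` e = (\<lambda>_. False) ` e"
      using s2[OF that] disj by (intro image_cong) (auto simp: f_def)
    then show ?thesis
      using plane_drawing_edge_nonempty[OF d2, of e] that by (simp add: image_constant_conv)
  qed
  have fib1: "fibre f G True = (V\<^sub>1, E\<^sub>1)"
  proof -
    have "{e \<in> edges G. f ` e = {True}} = E\<^sub>1"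
    proof (intro equalityI subsetI)
      fix e assume "e \<in> {e \<in> edges G. f ` e = {True}}"
      then show "e \<in> E\<^sub>1" using fE[of e] fE'[of e] by (auto simp: G_def)
    qed (simp add: fE G_def)
    then show ?thesis by (auto simp: fibre_def G_def f_def)
  qed
  have fib2: "fibre f G False = (V\<^sub>2, E\<^sub>2)"
  proof -
    have "{e \<in> edges G. f ` e = {False}} = E\<^sub>2"
    proof (intro equalityI subsetI)
      fix e assume "e \<in> {e \<in> edges G. f ` e = {False}}"
      then show "e \<in> E\<^sub>2" using fE[of e] fE'[of e] by (auto simp: G_def)
    qed (simp add: fE' G_def)
    then show ?thesis using disj by (auto simp: fibre_def G_def f_def)
  qed
  have off2: "z \<noteq> c\<^sub>2" if "z \<in> drawing_points (V\<^sub>2, E\<^sub>2) p\<^sub>2 \<gamma>\<^sub>2" for z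
    using c2(1) c2(2)[OF that] by auto
  have inj1: "inj_on \<phi>\<^sub>1 A" for A
    using c1(1) by (auto simp: \<phi>\<^sub>1_def inj_on_def)
  have cont1: "continuous_on A \<phi>\<^sub>1" for A
    unfolding \<phi>\<^sub>1_def using c1(1) by (intro continuous_intros) auto
  have cont2: "continuous_on (drawing_points (V\<^sub>2, E\<^sub>2) p\<^sub>2 \<gamma>\<^sub>2) \<phi>\<^sub>2"
    unfolding \<phi>\<^sub>2_def using off2 by (intro continuous_intros) auto
  have inj2: "inj_on \<phi>\<^sub>2 (drawing_points (V\<^sub>2, E\<^sub>2) p\<^sub>2 \<gamma>\<^sub>2)"
  proof (rule inj_onI)
    fix z w
    assume "z \<in> drawing_points (V\<^sub>2, E\<^sub>2) p\<^sub>2 \<gamma>\<^sub>2" "w \<in> drawing_points (V\<^sub>2, E\<^sub>2) p\<^sub>2 \<gamma>\<^sub>2" "\<phi>\<^sub>2 z = \<phi>\<^sub>2 w"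
    then show "z = w"
      using off2[of z] off2[of w] c2(1) by (simp add: \<phi>\<^sub>2_def frac_eq_eq)
  qed
  note t1 = plane_drawing_transport[OF d1 _ cont1 inj1, unfolded snd_conv fst_conv, OF s1]
  note t2 = plane_drawing_transport[OF d2 _ cont2 inj2, unfolded snd_conv fst_conv, OF s2]
  have draw: "plane_drawing (fibre f G i) (p i) (\<gamma> i)" for i
    using t1(1) t2(1) by (cases i) (simp_all add: fib1 fib2 p_def \<gamma>_def)
  have region: "drawing_points (fibre f G i) (p i) (\<gamma> i) \<subseteq> D i" for i
  proof (cases i)
    case True
    have "1 \<le> norm (\<phi>\<^sub>1 z)" if "z \<in> drawing_points (V\<^sub>1, E\<^sub>1) p\<^sub>1 \<gamma>\<^sub>1" for z
      using c1(1) c1(2)[OF that] by (simp add: \<phi>\<^sub>1_def norm_divide dist_norm norm_minus_commute)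
    with True show ?thesis
      using t1(2) by (auto simp: fib1 p_def \<gamma>_def D_def)
  next
    case False
    have "norm (\<phi>\<^sub>2 z) \<le> 1 / 2" if "z \<in> drawing_points (V\<^sub>2, E\<^sub>2) p\<^sub>2 \<gamma>\<^sub>2" for z
    proof -
      have "norm (\<phi>\<^sub>2 z) = dist c\<^sub>2 (p\<^sub>2 v\<^sub>2) / (2 * dist c\<^sub>2 z)"
        by (simp only: \<phi>\<^sub>2_def norm_divide norm_mult norm_numeral dist_norm norm_minus_commute)
      moreover have "0 < dist c\<^sub>2 z"
        using off2[OF that] by simp
      ultimately show ?thesis
        using c2(2)[OF that] by (simp add: divide_le_eq)
    qed
    with False show ?thesis
      using t2(2) by (auto simp: fib2 p_def \<gamma>_def D_def)
  qed
  have sub: "e \<subseteq> verts G" if "e \<in> edges G" for e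
    using that s1 s2 by (auto simp: G_def)
  have const: "\<exists>i. f ` e = {i}" if "e \<in> edges G" for e
    using that fE[of e] fE'[of e] unfolding G_def snd_conv by blast
  have disjD: "D i \<inter> D j = {}" if "i \<noteq> j" for i j
    using that by (cases i; cases j) (auto simp: D_def)
  define q where "q = (\<lambda>v. p (f v) v)"
  define \<delta> where "\<delta> = (\<lambda>e. \<gamma> (the_elem (f ` e)) e)"
  note glued = plane_drawing_glue[OF sub const draw region disjD, folded q_def \<delta>_def]
  have ends: "q v\<^sub>1 = 1" "q v\<^sub>2 = 1 / 2"
    using v disj c1(1) c2(1) by (auto simp: q_def p_def f_def \<phi>\<^sub>1_def \<phi>\<^sub>2_def)
  have "z \<in> {1, 1 / 2}" if "z \<in> closed_segment 1 (1 / 2)" "z \<in> drawing_points G q \<delta>" for z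
  proof -
    from that(1) obtain t where t: "0 \<le> t" "t \<le> 1" "z = (1 - t) *\<^sub>R 1 + t *\<^sub>R (1 / 2)"
      by (auto simp: in_segment)
    have z: "z = complex_of_real (1 - t / 2)"
      using t(3) by (simp add: complex_eq_iff)
    have "\<exists>i. z \<in> D i"
      using that(2) glued(2) region by blast
    then have "1 \<le> norm z \<or> norm z \<le> 1 / 2"
      by (auto simp: D_def split: if_splits)
    moreover have "norm z = 1 - t / 2"
      unfolding z norm_of_real using t(2) by simp
    ultimately have "t = 0 \<or> t = 1" using t by linarith
    then show ?thesis using z by auto
  qed
  then have free: "path_image (linepath 1 (1 / 2)) \<inter> drawing_points (V\<^sub>1 \<union> V\<^sub>2, E\<^sub>1 \<union> E\<^sub>2) q \<delta>
      \<subseteq> {q v\<^sub>1, q v\<^sub>2}"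
    unfolding ends path_image_linepath G_def by blast
  have "plane_drawing (V\<^sub>1 \<union> V\<^sub>2, insert {v\<^sub>1, v\<^sub>2} (E\<^sub>1 \<union> E\<^sub>2)) q
      (\<delta>({v\<^sub>1, v\<^sub>2} := linepath 1 (1 / 2)))"
    using glued(1) sub v ends unfolding G_def fst_conv snd_conv
    by (intro plane_drawing_add_edge free) auto
  then show ?thesis unfolding planar_def by blast
qed

section \<open>A periodic family of non-crossing segments\<close>

text \<open>The tile at the origin has corners \<open>0\<close> and \<open>4 + 4\<i>\<close>. Its lower half, the rectangle with corners
  \<open>0\<close> and \<open>4 + 2\<i>\<close>, is cut by the diagonal from \<open>2\<i>\<close> to \<open>4\<close> into two triangles; each triangle contains one
  further point, \<open>1 + \<i>\<close> or \<open>3 + \<i>\<close>, joined to the three corners. The vertical side from \<open>2\<i>\<close> to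
  \<open>0\<close> is present as well, and its continuation from \<open>2\<i>\<close> to \<open>4\<i>\<close> leads to the tile above. Each
  pair is ordered so that multiplication by \<open>n > 1\<close> goes from its first to its second component.\<close>

definition tile_struts :: "(complex \<times> complex) set" where
  "tile_struts =
    {(Complex 0 2, Complex 0 0), (Complex 0 2, Complex 4 0), (Complex 0 2, Complex 0 4),
     (Complex 0 2, Complex 1 1), (Complex 1 1, Complex 0 0), (Complex 1 1, Complex 4 0),
     (Complex 0 2, Complex 3 1), (Complex 4 2, Complex 3 1), (Complex 3 1, Complex 4 0)}"

definition tile_origin :: "int \<Rightarrow> int \<Rightarrow> complex" where
  "tile_origin a b = Complex (4 * of_int a) (4 * of_int b)"

definition strut :: "complex \<Rightarrow> complex \<Rightarrow> bool" where
  "strut P Q \<longleftrightarrow> (\<exists>a b. (P - tile_origin a b, Q - tile_origin a b) \<in> tile_struts)"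

text \<open>These are the end points of all struts; the four points listed are the ones that lie in the
  half-open tile at the origin.\<close>

definition nodes :: "complex set" where
  "nodes = {tile_origin a b + N | a b N. N \<in> {Complex 0 0, Complex 0 2, Complex 1 1, Complex 3 1}}"

lemma open_segment_translate:
  "z \<in> open_segment P Q \<Longrightarrow> z - (c::complex) \<in> open_segment (P - c) (Q - c)"
  using open_segment_translation_eq[of "- c" z P Q] by simp

lemma in_open_segment_Complex:
  assumes "z \<in> open_segment P Q"
  obtains t where "0 < t" "t < 1" "Re z = (1 - t) * Re P + t * Re Q" "Im z = (1 - t) * Im P + t * Im Q"
  using assms by (auto simp: in_segment)

text \<open>The half-open box is what makes the tile of an inner point unique, so that two crossing struts,
  or a strut and a node on it, must come from the same tile.\<close>

lemma tile_strut_box: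
  assumes "(P, Q) \<in> tile_struts" "z \<in> open_segment P Q"
  shows "0 \<le> Re z \<and> Re z < 4 \<and> 0 \<le> Im z \<and> Im z < 4"
  using assms(2)
  by (rule in_open_segment_Complex)
    (insert assms(1), simp add: tile_struts_def, elim disjE conjE; simp)

text \<open>Once the two struts are fixed, a common point amounts to two linear equations in the two
  parameters along the segments, so the 81 cases are problems of linear arithmetic.\<close>

lemma tile_struts_disjoint:
  assumes "(P, Q) \<in> tile_struts" "(P', Q') \<in> tile_struts"
    and "z \<in> open_segment P Q" "z \<in> open_segment P' Q'"
  shows "P = P' \<and> Q = Q'"
proof -
  obtain t where t: "0 < t" "t < 1" "Re z = (1 - t) * Re P + t * Re Q" "Im z = (1 - t) * Im P + t * Im Q"
    using assms(3) by (rule in_open_segment_Complex)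
  obtain s where s: "0 < s" "s < 1" "Re z = (1 - s) * Re P' + s * Re Q'" "Im z = (1 - s) * Im P' + s * Im Q'"
    using assms(4) by (rule in_open_segment_Complex)
  have eq: "(1 - t) * Re P + t * Re Q = (1 - s) * Re P' + s * Re Q'"
    "(1 - t) * Im P + t * Im Q = (1 - s) * Im P' + s * Im Q'"
    using t s by auto
  show ?thesis
    using assms(1,2) t(1,2) s(1,2) eq unfolding tile_struts_def
    by (simp only: insert_iff empty_iff prod.inject simp_thms)
      (elim disjE conjE; simp)
qed

lemma tile_strut_avoids_nodes:
  assumes "(P, Q) \<in> tile_struts"
    and "N \<in> {Complex 0 0, Complex 0 2, Complex 1 1, Complex 3 1}"
  shows "N \<notin> open_segment P Q"
proof
  assume "N \<in> open_segment P Q"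
  then obtain t where t: "0 < t" "t < 1" "Re N = (1 - t) * Re P + t * Re Q" "Im N = (1 - t) * Im P + t * Im Q"
    by (rule in_open_segment_Complex)
  show False
    using assms t unfolding tile_struts_def
    by (simp only: insert_iff empty_iff prod.inject simp_thms)
      (elim disjE conjE; simp)
qed

lemma tile_origin_unique:
  assumes "0 \<le> Re (z - tile_origin a b) \<and> Re (z - tile_origin a b) < 4 \<and>
     0 \<le> Im (z - tile_origin a b) \<and> Im (z - tile_origin a b) < 4"
    "0 \<le> Re (z - tile_origin a' b') \<and> Re (z - tile_origin a' b') < 4 \<and>
     0 \<le> Im (z - tile_origin a' b') \<and> Im (z - tile_origin a' b') < 4"
  shows "a = a' \<and> b = b'"
  using assms by (simp add: tile_origin_def)

lemma struts_disjoint: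
  assumes "strut P Q" "strut P' Q'" "z \<in> open_segment P Q" "z \<in> open_segment P' Q'"
  shows "P = P' \<and> Q = Q'"
proof -
  obtain a b where ab: "(P - tile_origin a b, Q - tile_origin a b) \<in> tile_struts"
    using assms(1) by (auto simp: strut_def)
  obtain a' b' where ab': "(P' - tile_origin a' b', Q' - tile_origin a' b') \<in> tile_struts"
    using assms(2) by (auto simp: strut_def)
  have "a = a' \<and> b = b'"
    using tile_strut_box[OF ab open_segment_translate[OF assms(3)]]
      tile_strut_box[OF ab' open_segment_translate[OF assms(4)]]
    by (intro tile_origin_unique[of z]) auto
  then show ?thesis
    using tile_struts_disjoint[OF ab _ open_segment_translate[OF assms(3)], of "P' - tile_origin a b" "Q' - tile_origin a b"]
      ab' open_segment_translate[OF assms(4), of "tile_origin a b"] by auto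
qed

lemma strut_avoids_nodes:
  assumes "strut P Q" "z \<in> nodes"
  shows "z \<notin> open_segment P Q"
proof
  assume z: "z \<in> open_segment P Q"
  obtain a b where ab: "(P - tile_origin a b, Q - tile_origin a b) \<in> tile_struts"
    using assms(1) by (auto simp: strut_def)
  obtain a' b' N where N: "z = tile_origin a' b' + N"
      "N \<in> {Complex 0 0, Complex 0 2, Complex 1 1, Complex 3 1}"
    using assms(2) unfolding nodes_def by blast
  have "0 \<le> Re N \<and> Re N < 4 \<and> 0 \<le> Im N \<and> Im N < 4"
    using N(2) by auto
  then have "a = a' \<and> b = b'"
    using tile_strut_box[OF ab open_segment_translate[OF z]] N(1)
    by (intro tile_origin_unique[of z]) auto
  then show False
    using tile_strut_avoids_nodes[OF ab N(2)] open_segment_translate[OF z, of "tile_origin a b"] N(1)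
    by simp
qed

lemma strut_irrefl: "strut P Q \<Longrightarrow> P \<noteq> Q"
  by (auto simp: strut_def tile_struts_def)

lemma strut_pointE:
  assumes "strut P Q" "z \<in> closed_segment P Q"
  obtains a b P\<^sub>0 Q\<^sub>0 t where "P = tile_origin a b + P\<^sub>0" "Q = tile_origin a b + Q\<^sub>0"
    "(P\<^sub>0, Q\<^sub>0) \<in> tile_struts" "0 \<le> t" "t \<le> 1"
    "Re z = 4 * of_int a + ((1 - t) * Re P\<^sub>0 + t * Re Q\<^sub>0)"
    "Im z = 4 * of_int b + ((1 - t) * Im P\<^sub>0 + t * Im Q\<^sub>0)"
    "0 \<le> (1 - t) * Re P\<^sub>0 + t * Re Q\<^sub>0" "(1 - t) * Re P\<^sub>0 + t * Re Q\<^sub>0 \<le> 4"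
    "0 \<le> (1 - t) * Im P\<^sub>0 + t * Im Q\<^sub>0" "(1 - t) * Im P\<^sub>0 + t * Im Q\<^sub>0 \<le> 4"
proof -
  obtain a b where ab: "(P - tile_origin a b, Q - tile_origin a b) \<in> tile_struts"
    using assms(1) by (auto simp: strut_def)
  define P\<^sub>0 where "P\<^sub>0 = P - tile_origin a b"
  define Q\<^sub>0 where "Q\<^sub>0 = Q - tile_origin a b"
  have PQ: "P = tile_origin a b + P\<^sub>0" "Q = tile_origin a b + Q\<^sub>0" "(P\<^sub>0, Q\<^sub>0) \<in> tile_struts"
    using ab by (simp_all add: P\<^sub>0_def Q\<^sub>0_def)
  obtain t where t: "0 \<le> t" "t \<le> 1" "Re z = (1 - t) * Re P + t * Re Q" "Im z = (1 - t) * Im P + t * Im Q"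
    using assms(2) by (auto simp: in_segment)
  have "Re z = 4 * of_int a + ((1 - t) * Re P\<^sub>0 + t * Re Q\<^sub>0)"
    "Im z = 4 * of_int b + ((1 - t) * Im P\<^sub>0 + t * Im Q\<^sub>0)"
    using t(3,4) by (simp_all add: PQ tile_origin_def algebra_simps)
  moreover have "0 \<le> (1 - t) * Re P\<^sub>0 + t * Re Q\<^sub>0" "(1 - t) * Re P\<^sub>0 + t * Re Q\<^sub>0 \<le> 4"
    "0 \<le> (1 - t) * Im P\<^sub>0 + t * Im Q\<^sub>0" "(1 - t) * Im P\<^sub>0 + t * Im Q\<^sub>0 \<le> 4"
    using PQ(3) t(1,2) unfolding tile_struts_def
    by (simp only: insert_iff empty_iff prod.inject simp_thms, elim disjE conjE; simp)+
  ultimately show thesis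
    using that PQ t(1,2) by blast
qed

lemma near_imp_coordinates:
  fixes c z :: complex
  assumes "dist c z < 1"
  shows "\<bar>Re c - Re z\<bar> < 1" "\<bar>Im c - Im z\<bar> < 1"
  using assms abs_Re_le_cmod[of "c - z"] abs_Im_le_cmod[of "c - z"]
  by (simp_all add: dist_norm)

text \<open>The point \<open>2\<i>\<close> lies on the boundary of the disc of radius \<open>1\<close> about \<open>-1 + 2\<i>\<close>, and the point \<open>0\<close> on
  that of the disc of radius \<open>1\<close> about \<open>1\<close>. These are the discs needed to attach an edge at the vertices
  \<open>1\<close> and \<open>7\<close>. The struts that enter the first disc all end at the node \<open>-1 + \<i>\<close>, and those that enter the
  second all end at \<open>1 + \<i>\<close>, so leaving out one node frees the disc. Since the tiles that
  meet a disc are known, the proofs only compare coordinates.\<close>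

lemma strut_outside_left_disc:
  assumes "strut P Q" "z \<in> closed_segment P Q" "P \<noteq> Complex (-1) 1" "Q \<noteq> Complex (-1) 1"
  shows "1 \<le> dist (Complex (-1) 2) z"
proof (rule ccontr)
  assume "\<not> 1 \<le> dist (Complex (-1) 2) z"
  then have z: "-2 < Re z" "Re z < 0" "1 < Im z" "Im z < 3"
    using near_imp_coordinates[of "Complex (-1) 2" z] by auto
  obtain a b P\<^sub>0 Q\<^sub>0 t where PQ: "P = tile_origin a b + P\<^sub>0" "Q = tile_origin a b + Q\<^sub>0"
    "(P\<^sub>0, Q\<^sub>0) \<in> tile_struts" and t: "0 \<le> t" "t \<le> 1"
    and tz: "Re z = 4 * of_int a + ((1 - t) * Re P\<^sub>0 + t * Re Q\<^sub>0)"
    "Im z = 4 * of_int b + ((1 - t) * Im P\<^sub>0 + t * Im Q\<^sub>0)"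
    and box: "0 \<le> (1 - t) * Re P\<^sub>0 + t * Re Q\<^sub>0" "(1 - t) * Re P\<^sub>0 + t * Re Q\<^sub>0 \<le> 4"
    "0 \<le> (1 - t) * Im P\<^sub>0 + t * Im Q\<^sub>0" "(1 - t) * Im P\<^sub>0 + t * Im Q\<^sub>0 \<le> 4"
    using assms(1,2) by (rule strut_pointE)
  have "a = -1" using z(1,2) tz(1) box(1,2) by linarith
  moreover have "b = 0" using z(3,4) tz(2) box(3,4) by linarith
  ultimately show False
    using PQ(3) t tz z assms(3,4) unfolding tile_struts_def PQ(1,2) tile_origin_def
    by (simp only: insert_iff empty_iff prod.inject simp_thms)
      (elim disjE conjE; simp add: complex_eq_iff; linarith)
qed

lemma strut_outside_right_disc:
  assumes "strut P Q" "z \<in> closed_segment P Q" "P \<noteq> Complex 1 1" "Q \<noteq> Complex 1 1"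
  shows "1 \<le> dist (Complex 1 0) z"
proof (rule ccontr)
  assume "\<not> 1 \<le> dist (Complex 1 0) z"
  then have z: "0 < Re z" "Re z < 2" "-1 < Im z" "Im z < 1"
    using near_imp_coordinates[of "Complex 1 0" z] by auto
  obtain a b P\<^sub>0 Q\<^sub>0 t where PQ: "P = tile_origin a b + P\<^sub>0" "Q = tile_origin a b + Q\<^sub>0"
    "(P\<^sub>0, Q\<^sub>0) \<in> tile_struts" and t: "0 \<le> t" "t \<le> 1"
    and tz: "Re z = 4 * of_int a + ((1 - t) * Re P\<^sub>0 + t * Re Q\<^sub>0)"
    "Im z = 4 * of_int b + ((1 - t) * Im P\<^sub>0 + t * Im Q\<^sub>0)"
    and box: "0 \<le> (1 - t) * Re P\<^sub>0 + t * Re Q\<^sub>0" "(1 - t) * Re P\<^sub>0 + t * Re Q\<^sub>0 \<le> 4"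
    "0 \<le> (1 - t) * Im P\<^sub>0 + t * Im Q\<^sub>0" "(1 - t) * Im P\<^sub>0 + t * Im Q\<^sub>0 \<le> 4"
    using assms(1,2) by (rule strut_pointE)
  have "a = 0" using z(1,2) tz(1) box(1,2) by linarith
  moreover have "b = 0 \<or> b = -1" using z(3,4) tz(2) box(3,4) by linarith
  ultimately show False
    using PQ(3) t tz z assms(3,4) unfolding tile_struts_def PQ(1,2) tile_origin_def
    by (simp only: insert_iff empty_iff prod.inject simp_thms)
      (elim disjE conjE; simp add: complex_eq_iff; linarith)
qed

lemma node_outside_left_disc:
  assumes "z \<in> nodes" "z \<noteq> Complex (-1) 1"
  shows "1 \<le> dist (Complex (-1) 2) z"
proof (rule ccontr)
  assume "\<not> 1 \<le> dist (Complex (-1) 2) z"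
  then have z: "-2 < Re z" "Re z < 0" "1 < Im z" "Im z < 3"
    using near_imp_coordinates[of "Complex (-1) 2" z] by auto
  obtain a b N where N: "z = tile_origin a b + N"
      "N \<in> {Complex 0 0, Complex 0 2, Complex 1 1, Complex 3 1}"
    using assms(1) unfolding nodes_def by blast
  then have "a = -1" "b = 0"
    using z by (auto simp: tile_origin_def)
  then show False
    using N z assms(2) by (auto simp: tile_origin_def complex_eq_iff)
qed

lemma node_outside_right_disc:
  assumes "z \<in> nodes" "z \<noteq> Complex 1 1"
  shows "1 \<le> dist (Complex 1 0) z"
proof (rule ccontr)
  assume "\<not> 1 \<le> dist (Complex 1 0) z"
  then have z: "0 < Re z" "Re z < 2" "-1 < Im z" "Im z < 1"
    using near_imp_coordinates[of "Complex 1 0" z] by auto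
  obtain a b N where N: "z = tile_origin a b + N"
      "N \<in> {Complex 0 0, Complex 0 2, Complex 1 1, Complex 3 1}"
    using assms(1) unfolding nodes_def by blast
  then have "a = 0" "b = 0 \<or> b = -1"
    using z by (auto simp: tile_origin_def)
  then show False
    using N z assms(2) by (auto simp: tile_origin_def complex_eq_iff)
qed

lemma strut_drawing:
  fixes p :: "'a \<Rightarrow> complex"
  assumes inj: "inj_on p V" and node: "p ` V \<subseteq> nodes"
    and edge: "\<And>e. e \<in> E \<Longrightarrow> \<exists>u v. e = {u, v} \<and> u \<in> V \<and> v \<in> V \<and> strut (p u) (p v)"
  obtains \<gamma> where "plane_drawing (V, E) p \<gamma>"
    and "\<And>z. z \<in> drawing_points (V, E) p \<gamma> \<Longrightarrow>
      z \<in> p ` V \<or> (\<exists>u\<in>V. \<exists>v\<in>V. strut (p u) (p v) \<and> z \<in> closed_segment (p u) (p v))"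
proof -
  from edge obtain s t where st:
    "\<And>e. e \<in> E \<Longrightarrow> e = {s e, t e} \<and> s e \<in> V \<and> t e \<in> V \<and> strut (p (s e)) (p (t e))"
    by metis
  have "plane_drawing (V, E) p (\<lambda>e. linepath (p (s e)) (p (t e)))"
  proof (rule plane_drawing_straight[OF inj])
    fix e assume e: "e \<in> E"
    show "e = {s e, t e} \<and> s e \<noteq> t e \<and> s e \<in> V \<and> t e \<in> V"
      using st[OF e] strut_irrefl by metis
    show "p w \<notin> open_segment (p (s e)) (p (t e))" if "w \<in> V" for w
      using st[OF e] strut_avoids_nodes node that by blast
    fix f assume f: "f \<in> E" "e \<noteq> f"
    show "open_segment (p (s e)) (p (t e)) \<inter> open_segment (p (s f)) (p (t f)) = {}"
    proof (rule ccontr)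
      assume "open_segment (p (s e)) (p (t e)) \<inter> open_segment (p (s f)) (p (t f)) \<noteq> {}"
      then have "p (s e) = p (s f) \<and> p (t e) = p (t f)"
        using struts_disjoint st[OF e] st[OF f(1)] by blast
      then have "s e = s f \<and> t e = t f"
        using inj st[OF e] st[OF f(1)] by (meson inj_onD)
      then show False using st[OF e] st[OF f(1)] f(2) by metis
    qed
  qed
  moreover have "z \<in> p ` V \<or> (\<exists>u\<in>V. \<exists>v\<in>V. strut (p u) (p v) \<and> z \<in> closed_segment (p u) (p v))"
    if "z \<in> drawing_points (V, E) p (\<lambda>e. linepath (p (s e)) (p (t e)))" for z
    using that st unfolding drawing_points_def fst_conv snd_conv path_image_linepath by blast
  ultimately show thesis by (rule that)
qed

section \<open>Arithmetic of rationals modulo powers of 2, 3 and 5\<close>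

text \<open>The \<open>p\<close>-adic valuation of a rational number, for prime \<open>p\<close>.\<close>

definition val :: "int \<Rightarrow> rat \<Rightarrow> int" where
  "val p q = int (multiplicity p (fst (quotient_of q))) - int (multiplicity p (snd (quotient_of q)))"

lemma val_mult:
  assumes "prime p" "x \<noteq> 0" "y \<noteq> 0"
  shows "val p (x * y) = val p x + val p y"
proof -
  obtain a b where x: "quotient_of x = (a, b)" by force
  obtain c d where y: "quotient_of y = (c, d)" by force
  obtain m n where xy: "quotient_of (x * y) = (m, n)" by force
  have pos: "b > 0" "d > 0" "n > 0"
    using x y xy by (auto dest: quotient_of_denom_pos)
  have eqs: "x = of_int a / of_int b" "y = of_int c / of_int d" "x * y = of_int m / of_int n"
    using x y xy by (auto dest: quotient_of_div)
  have nz: "a \<noteq> 0" "c \<noteq> 0" "m \<noteq> 0"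
    using eqs assms by auto
  have "of_int (a * c * n) = (of_int (m * b * d) :: rat)"
  proof -
    have "of_int a = x * of_int b" "of_int c = y * of_int d" "of_int m = x * y * of_int n"
      using eqs pos by simp_all
    then show ?thesis by (simp add: mult_ac)
  qed
  then have "a * c * n = m * b * d" by (simp only: of_int_eq_iff)
  then have "multiplicity p (a * c * n) = multiplicity p (m * b * d)" by simp
  moreover have "multiplicity p (i * j) = multiplicity p i + multiplicity p j" if "i \<noteq> 0" "j \<noteq> 0" for i j
    using prime_elem_multiplicity_mult_distrib[OF prime_imp_prime_elem[OF assms(1)] that] .
  ultimately have "multiplicity p a + multiplicity p c + multiplicity p n
      = multiplicity p m + multiplicity p b + multiplicity p d"
    using pos nz by simp
  then show ?thesis
    by (simp add: val_def x y xy)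
qed

lemma val_numeral: "val p (numeral k) = int (multiplicity p (numeral k))"
  by (simp add: val_def)

lemma val_small_numerals:
  "val 2 2 = 1" "val 2 3 = 0" "val 2 5 = 0" "val 2 7 = 0"
  "val 3 2 = 0" "val 3 3 = 1" "val 3 5 = 0" "val 3 7 = 0"
  "val 5 2 = 0" "val 5 3 = 0" "val 5 5 = 1" "val 5 7 = 0"
  by (simp_all add: val_numeral not_dvd_imp_multiplicity_0 multiplicity_self)

lemma val_one: "val p 1 = 0"
  by (simp add: val_def)

definition core :: "rat \<Rightarrow> rat" where
  "core q = q / (2 powi val 2 q * 3 powi val 3 q * 5 powi val 5 q)"

lemma primes_2_3_5: "prime (2::int)" "prime (3::int)" "prime (5::int)"
  by simp_all

lemma core_mult:
  assumes "x \<noteq> 0" "y \<noteq> 0"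
  shows "core (x * y) = core x * core y"
  using assms
  by (simp add: core_def val_mult power_int_add)

lemma core_small_numerals: "core 1 = 1" "core 2 = 1" "core 3 = 1" "core 5 = 1" "core 7 = 7"
  by (simp_all add: core_def val_small_numerals val_one)

text \<open>Two numbers that differ by a factor \<open>2 ^ k\<close> and are less than a factor \<open>2\<close> apart are equal. This is
  why the interval \<open>[1,2)\<close>, \<open>[2,4)\<close> or \<open>[4,7]\<close> of a vertex replaces its exponent of \<open>2\<close>.\<close>

lemma power2_ratio_unique:
  fixes x y :: rat
  assumes "x * 2 powi i = y * 2 powi j" "x < 2 * y" "y < 2 * x"
  shows "x = y"
proof -
  have False if "x * 2 powi i = y * 2 powi j" "y < 2 * x" "x < 2 * y" "i < j" for i j and x y :: rat
  proof -
    have pos: "(0::rat) < 2 powi i" by simp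
    have "2 * 2 powi i = (2::rat) powi (i + 1)" by (simp add: power_int_add)
    also have "\<dots> \<le> 2 powi j" using that(4) by (intro power_int_increasing) auto
    finally have "y * (2 * 2 powi i) \<le> y * 2 powi j"
      using that(2,3) by (intro mult_left_mono) auto
    also have "\<dots> = x * 2 powi i" using that(1) by simp
    finally have "(2 * y) * 2 powi i \<le> x * 2 powi i" by (simp add: mult_ac)
    then have "2 * y \<le> x" using pos by (rule mult_right_le_imp_le)
    then show False using that(3) by simp
  qed
  from this[of x i y j] this[of y j x i] assms have "i = j" by (metis linorder_neqE)
  then show ?thesis using assms(1) by simp
qed

section \<open>Drawing and colouring the divisor graph\<close>

text \<open>The offset of a vertex from its lattice point. A vertex in \<open>[2,4)\<close> goes to the right side exactly if
  its triple is at most \<open>7\<close>: the triple lies in the tile to the right. If \<open>q > 7/3\<close>, then \<open>q\<close> may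
  instead be the triple of a vertex of the tile to the left.\<close>

definition slot :: "rat \<Rightarrow> int \<times> int" where
  "slot q = (if q < 2 then (0, 2) else if 3 * q \<le> 7 then (1, 1) else if q < 4 then (-1, 1) else (0, 0))"

definition place :: "rat \<Rightarrow> complex" where
  "place q = tile_origin (val 3 q) (val 5 q) + Complex (of_int (fst (slot q))) (of_int (snd (slot q)))"

lemma place_in_nodes: "place q \<in> nodes"
proof -
  have "tile_origin a b + Complex (-1) 1 = tile_origin (a - 1) b + Complex 3 1" for a b
    by (simp add: tile_origin_def complex_eq_iff)
  then show ?thesis
    unfolding place_def slot_def nodes_def by (auto split: if_splits)
qed

lemma place_eq_Complex_iff:
  "place q = Complex (of_int i) (of_int j) \<longleftrightarrow>
     4 * val 3 q + fst (slot q) = i \<and> 4 * val 5 q + snd (slot q) = j"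
proof -
  have "place q = Complex (of_int (4 * val 3 q + fst (slot q))) (of_int (4 * val 5 q + snd (slot q)))"
    by (simp add: place_def tile_origin_def complex_eq_iff)
  then show ?thesis by (simp only: complex.inject of_int_eq_iff)
qed

text \<open>The coordinates of the point modulo \<open>4\<close> reveal the slot, hence the interval; the
  lattice point then gives the exponents of \<open>3\<close> and \<open>5\<close>, and the exponent of \<open>2\<close> follows from the
  interval.\<close>

lemma place_inj:
  assumes "place x = place y" "core x = core y" "x \<in> {1..7}" "y \<in> {1..7}"
  shows "x = y"
proof -
  have "place y = Complex (of_int (4 * val 3 y + fst (slot y))) (of_int (4 * val 5 y + snd (slot y)))"
    by (simp only: place_eq_Complex_iff)
  then have eq: "4 * val 3 x + fst (slot x) = 4 * val 3 y + fst (slot y)"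
    "4 * val 5 x + snd (slot x) = 4 * val 5 y + snd (slot y)"
    using assms(1) place_eq_Complex_iff by metis+
  then have "fst (slot x) mod 4 = fst (slot y) mod 4" "snd (slot x) mod 4 = snd (slot y) mod 4"
    by presburger+
  then have slot: "slot x = slot y"
    by (auto simp: slot_def split: if_splits)
  then have ab: "val 3 x = val 3 y" "val 5 x = val 5 y"
    using eq by simp_all
  have band: "x < 2 * y" "y < 2 * x"
    using slot assms(3,4) by (auto simp: slot_def split: if_splits)
  have "x / (2 powi val 2 x) = y / (2 powi val 2 y)"
    using assms(2) unfolding core_def ab by (simp add: field_simps)
  then have "x * 2 powi val 2 y = y * 2 powi val 2 x"
    by (simp add: field_simps)
  then show ?thesis
    using band by (rule power2_ratio_unique)
qed

lemma strutI: "(P - tile_origin a b, Q - tile_origin a b) \<in> tile_struts \<Longrightarrow> strut P Q"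
  by (auto simp: strut_def)

text \<open>Here the size of \<open>u\<close> enters: the bound \<open>n * u \<le> 7\<close> limits the possible slots of both ends. For
  instance \<open>3 * u\<close> with \<open>u < 4/3\<close> lies in \<open>[3,4)\<close>, hence above \<open>7/3\<close>, and takes the left side of the lattice point to the right.\<close>

lemma divisor_edge_strut:
  assumes "1 \<le> u" "2 \<le> n" "of_nat n * u \<le> 7" "u \<noteq> 1 \<or> n \<noteq> 7"
  shows "core (of_nat n * u) = core u" "strut (place u) (place (of_nat n * u))"
proof -
  have u: "u \<noteq> 0" using assms(1) by simp
  have "of_nat n \<le> of_nat n * u" using mult_left_mono[OF assms(1), of "of_nat n"] by simp
  then have "(of_nat n :: rat) \<le> of_nat 7" using assms(3) by simp
  then have "n \<le> 7" by (simp only: of_nat_le_iff)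
  moreover have "n \<noteq> 7" using assms(1,3,4) by auto
  ultimately have "n \<in> {2, 3, 4, 5, 6}" using assms(2) by auto
  then consider "n = 2" | "n = 3" | "n = 4" | "n = 5" | "n = 6" by blast
  note cases = this
  have v: "val p (2 * u) = val p 2 + val p u" "val p (3 * u) = val p 3 + val p u"
    "val p (4 * u) = val p 2 + val p 2 + val p u" "val p (5 * u) = val p 5 + val p u"
    "val p (6 * u) = val p 2 + val p 3 + val p u" if "prime p" for p
    using val_mult[OF that, of 2 u] val_mult[OF that, of 3 u] val_mult[OF that, of 5 u]
      val_mult[OF that, of 2 "2 * u"] val_mult[OF that, of 2 "3 * u"] u by simp_all
  have c: "core (2 * u) = core u" "core (3 * u) = core u" "core (5 * u) = core u"
    "core (4 * u) = core u" "core (6 * u) = core u"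
    using core_mult[of 2 u] core_mult[of 3 u] core_mult[of 5 u] core_mult[of 2 "2 * u"]
      core_mult[of 2 "3 * u"] u by (simp_all add: core_small_numerals)
  from cases c show "core (of_nat n * u) = core u"
    by cases simp_all
  define a b where "a = val 3 u" and "b = val 5 u"
  note pl = place_def slot_def v primes_2_3_5 val_small_numerals tile_origin_def complex_eq_iff tile_struts_def
    a_def b_def
  from cases show "strut (place u) (place (of_nat n * u))"
  proof cases
    case 1
    show ?thesis
    proof (cases "u < 2 \<and> 6 * u \<le> 7 \<or> 3 * u \<le> 7 \<and> 2 \<le> u")
      case True
      then show ?thesis using 1 assms(1,3) by (intro strutI[of _ a b]) (auto simp: pl)
    next
      case False
      \<comment> \<open>One end has the offset \<open>-1 + \<i>\<close> and so lies in the tile on the left.\<close>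
      then show ?thesis using 1 assms(1,3) by (intro strutI[of _ "a - 1" b]) (auto simp: pl)
    qed
  next
    case 2
    then show ?thesis using assms(1,3) by (intro strutI[of _ a b]) (auto simp: pl)
  next
    case 3
    then show ?thesis using assms(1,3) by (intro strutI[of _ a b]) (auto simp: pl)
  next
    case 4
    then show ?thesis using assms(1,3) by (intro strutI[of _ a b]) (auto simp: pl)
  next
    case 5
    then show ?thesis using assms(1,3) by (intro strutI[of _ a b]) (auto simp: pl)
  qed
qed

abbreviation (input) Q_1_7 :: "rat sgraph" where "Q_1_7 \<equiv> rat_div_graph {1..7}"

lemma divisor_edgeE:
  assumes "e \<in> edges Q_1_7"
  obtains u n where "e = {u, of_nat n * u}" "1 \<le> u" "2 \<le> n" "of_nat n * u \<le> 7"
proof -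
  obtain x y where xy: "e = {x, y}" "x \<in> {1..7}" "y \<in> {1..7}" "rat_div_adjacent x y"
    using assms by (auto simp: rat_div_graph_def)
  then obtain n where n: "1 \<le> n" "x = of_nat n * y \<or> y = of_nat n * x" and ne: "x \<noteq> y"
    by (auto simp: rat_div_adjacent_def)
  have "n \<noteq> 1" using n(2) ne by auto
  then have n2: "2 \<le> n" using n(1) by simp
  from n(2) show thesis
  proof
    assume "x = of_nat n * y"
    then show thesis using that[of y n] xy n2 by (simp add: insert_commute)
  next
    assume "y = of_nat n * x"
    then show thesis using that[of x n] xy n2 by simp
  qed
qed

lemma coset_drawing:
  assumes core: "\<And>v. v \<in> V \<Longrightarrow> core v = c" and V: "V \<subseteq> {1..7}"
    and E: "E \<subseteq> edges Q_1_7" "\<And>e. e \<in> E \<Longrightarrow> e \<subseteq> V"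
  obtains \<gamma> where "plane_drawing (V, E) place \<gamma>"
    and "\<And>z. z \<in> drawing_points (V, E) place \<gamma> \<Longrightarrow>
      z \<in> place ` V \<or> (\<exists>u\<in>V. \<exists>v\<in>V. strut (place u) (place v) \<and> z \<in> closed_segment (place u) (place v))"
proof (rule strut_drawing)
  show "inj_on place V"
    using place_inj core V by (intro inj_onI) (metis subsetD)
  show "place ` V \<subseteq> nodes" using place_in_nodes by blast
  fix e assume e: "e \<in> E"
  then obtain u n where un: "e = {u, of_nat n * u}" "1 \<le> u" "2 \<le> n" "of_nat n * u \<le> 7"
    using E(1) divisor_edgeE by blast
  have uV: "u \<in> V" "of_nat n * u \<in> V" using E(2)[OF e] un(1) by auto
  have "u \<noteq> 1 \<or> n \<noteq> 7"
  proof (rule ccontr)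
    assume "\<not> (u \<noteq> 1 \<or> n \<noteq> 7)"
    then have "core 1 = core 7" using core uV by force
    then show False by (simp add: core_small_numerals)
  qed
  then show "\<exists>u v. e = {u, v} \<and> u \<in> V \<and> v \<in> V \<and> strut (place u) (place v)"
    using divisor_edge_strut(2) un uV by blast
qed (use that in blast)

text \<open>The two points that would obstruct the free discs stay empty. In the coset of \<open>1\<close> only \<open>2\<close> could
  be placed at \<open>-1 + \<i>\<close>, but \<open>2 \<le> 7/3\<close> belongs to the right side; in the coset of \<open>7\<close> only \<open>7/2\<close> could be
  placed at \<open>1 + \<i>\<close>, but \<open>7/2 > 7/3\<close> belongs to the left side.\<close>

lemma place_not_in_free_discs:
  assumes "x \<in> {1..7}"
  shows "core x = 1 \<Longrightarrow> place x \<noteq> Complex (-1) 1"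
    and "core x = 7 \<Longrightarrow> place x \<noteq> Complex 1 1"
proof -
  have slot_range: "-1 \<le> fst (slot x)" "fst (slot x) \<le> 1" "0 \<le> snd (slot x)" "snd (slot x) \<le> 2"
    by (auto simp: slot_def)
  show "place x \<noteq> Complex (-1) 1" if c: "core x = 1"
  proof
    assume "place x = Complex (-1) 1"
    then have "4 * val 3 x + fst (slot x) = -1" "4 * val 5 x + snd (slot x) = 1"
      using place_eq_Complex_iff[of x "-1" 1] by simp_all
    then have v: "val 3 x = 0" "val 5 x = 0" and "fst (slot x) = -1" "snd (slot x) = 1"
      using slot_range by presburger+
    then have x: "7 < 3 * x" "x < 4"
      by (auto simp: slot_def split: if_splits)
    have "x * 2 powi 1 = 2 * 2 powi val 2 x"
      using c v by (simp add: core_def)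
    then have "x = 2"
      by (rule power2_ratio_unique) (use x in auto)
    with x show False by simp
  qed
  show "place x \<noteq> Complex 1 1" if c: "core x = 7"
  proof
    assume "place x = Complex 1 1"
    then have "4 * val 3 x + fst (slot x) = 1" "4 * val 5 x + snd (slot x) = 1"
      using place_eq_Complex_iff[of x 1 1] by simp_all
    then have v: "val 3 x = 0" "val 5 x = 0" and "fst (slot x) = 1" "snd (slot x) = 1"
      using slot_range by presburger+
    then have x: "2 \<le> x" "3 * x \<le> 7"
      by (auto simp: slot_def split: if_splits)
    \<comment> \<open>Here \<open>x = 7 * 2 powi val 2 x\<close>, which is rewritten as \<open>7/2\<close> times a power of \<open>2\<close>.\<close>
    have "x * 2 powi 1 = 7 / 2 * 2 powi (val 2 x + 2)"
      using c v by (simp add: core_def power_int_add field_simps)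
    then have "x = 7 / 2"
      by (rule power2_ratio_unique) (use x in auto)
    with x show False by simp
  qed
qed

lemma planar_cosets_of_1_and_7:
  fixes E\<^sub>1 E\<^sub>2 :: "rat set set"
  defines "V\<^sub>1 \<equiv> {v \<in> {1..7}. core v = 1}" and "V\<^sub>2 \<equiv> {v \<in> {1..7}. core v = 7}"
  assumes E1: "E\<^sub>1 \<subseteq> edges Q_1_7" "\<And>e. e \<in> E\<^sub>1 \<Longrightarrow> e \<subseteq> V\<^sub>1"
    and E2: "E\<^sub>2 \<subseteq> edges Q_1_7" "\<And>e. e \<in> E\<^sub>2 \<Longrightarrow> e \<subseteq> V\<^sub>2"
  shows "planar (V\<^sub>1 \<union> V\<^sub>2, insert {1, 7} (E\<^sub>1 \<union> E\<^sub>2))"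
proof -
  obtain \<gamma>\<^sub>1 where d1: "plane_drawing (V\<^sub>1, E\<^sub>1) place \<gamma>\<^sub>1"
    "\<And>z. z \<in> drawing_points (V\<^sub>1, E\<^sub>1) place \<gamma>\<^sub>1 \<Longrightarrow>
      z \<in> place ` V\<^sub>1 \<or> (\<exists>u\<in>V\<^sub>1. \<exists>v\<in>V\<^sub>1. strut (place u) (place v) \<and> z \<in> closed_segment (place u) (place v))"
    by (rule coset_drawing[OF _ _ E1, of 1]) (auto simp: V\<^sub>1_def)
  obtain \<gamma>\<^sub>2 where d2: "plane_drawing (V\<^sub>2, E\<^sub>2) place \<gamma>\<^sub>2"
    "\<And>z. z \<in> drawing_points (V\<^sub>2, E\<^sub>2) place \<gamma>\<^sub>2 \<Longrightarrow>
      z \<in> place ` V\<^sub>2 \<or> (\<exists>u\<in>V\<^sub>2. \<exists>v\<in>V\<^sub>2. strut (place u) (place v) \<and> z \<in> closed_segment (place u) (place v))"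
    by (rule coset_drawing[OF _ _ E2, of 7]) (auto simp: V\<^sub>2_def)
  have pl: "place 1 = Complex 0 2" "place 7 = Complex 0 0"
    by (simp_all add: place_def slot_def tile_origin_def val_one val_small_numerals complex_eq_iff)
  have dist: "dist (Complex (-1) 2) (place 1) = 1" "dist (Complex 1 0) (place 7) = 1"
    by (simp_all add: pl dist_norm cmod_def)
  show ?thesis
  proof (rule planar_bridge[OF d1(1) d2(1) E1(2) E2(2)])
    show "V\<^sub>1 \<inter> V\<^sub>2 = {}" by (auto simp: V\<^sub>1_def V\<^sub>2_def)
    show "1 \<in> V\<^sub>1" "7 \<in> V\<^sub>2" by (auto simp: V\<^sub>1_def V\<^sub>2_def core_small_numerals)
    show "place 1 \<noteq> Complex (-1) 2" "place 7 \<noteq> Complex 1 0"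
      by (simp_all add: pl)
    show "dist (Complex (-1) 2) (place 1) \<le> dist (Complex (-1) 2) z"
      if "z \<in> drawing_points (V\<^sub>1, E\<^sub>1) place \<gamma>\<^sub>1" for z
      unfolding dist
      using d1(2)[OF that] place_not_in_free_discs(1) place_in_nodes node_outside_left_disc
        strut_outside_left_disc
      unfolding V\<^sub>1_def by blast
    show "dist (Complex 1 0) (place 7) \<le> dist (Complex 1 0) z"
      if "z \<in> drawing_points (V\<^sub>2, E\<^sub>2) place \<gamma>\<^sub>2" for z
      unfolding dist
      using d2(2)[OF that] place_not_in_free_discs(2) place_in_nodes node_outside_right_disc
        strut_outside_right_disc
      unfolding V\<^sub>2_def by blast
  qed auto
qed

text \<open>The function \<open>f\<close> below merges the cosets of \<open>1\<close> and \<open>7\<close>, so that it is constant on every edge,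
  including \<open>{1, 7}\<close>.\<close>

lemma planar_Q_1_7: "planar Q_1_7"
proof (rule planar_disjoint_union)
  define f where "f = (\<lambda>v. if core v = 7 then 1 else core v)"
  have sub: "e \<subseteq> {1..7}" if "e \<in> edges Q_1_7" for e
    using that by (auto simp: rat_div_graph_def)
  have split: "e = {1, 7} \<or> (\<exists>c. core ` e = {c})" if "e \<in> edges Q_1_7" for e
  proof -
    from that obtain u n where un: "e = {u, of_nat n * u}" "1 \<le> u" "2 \<le> n" "of_nat n * u \<le> 7"
      by (rule divisor_edgeE)
    show ?thesis
    proof (cases "u \<noteq> 1 \<or> n \<noteq> 7")
      case True
      then show ?thesis using divisor_edge_strut(1)[OF un(2-4)] un(1) by simp
    qed (use un(1) in simp)
  qed
  have f_image: "f ` e = {if c = 7 then 1 else c}" if "core ` e = {c}" for e c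
  proof -
    have "f ` e = (\<lambda>c. if c = 7 then 1 else c) ` core ` e"
      unfolding image_image f_def ..
    then show ?thesis unfolding that by simp
  qed
  show "e \<subseteq> verts Q_1_7" if "e \<in> edges Q_1_7" for e
    using sub[OF that] by (simp add: rat_div_graph_def)
  show "\<exists>i. f ` e = {i}" if "e \<in> edges Q_1_7" for e
    using split[OF that]
  proof
    assume "e = {1, 7}"
    then show ?thesis by (simp add: f_def core_small_numerals)
  next
    assume "\<exists>c. core ` e = {c}"
    then show ?thesis using f_image by blast
  qed
  show "countable (f ` verts Q_1_7)" by simp
  show "planar (fibre f Q_1_7 i)" for i
  proof (cases "i = 1")
    case False
    let ?V = "{v \<in> {1..7}. f v = i}" and ?E = "{e \<in> edges Q_1_7. f ` e = {i}}"
    obtain \<gamma> where "plane_drawing (?V, ?E) place \<gamma>"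
    proof (rule coset_drawing)
      show "core v = i" if "v \<in> ?V" for v
        using that False by (auto simp: f_def split: if_splits)
      show "e \<subseteq> ?V" if "e \<in> ?E" for e
        using that sub[of e] by blast
    qed (use that in auto)
    then show ?thesis unfolding planar_def fibre_def by (auto simp: rat_div_graph_def)
  next
    case True
    let ?V = "\<lambda>c. {v \<in> {1..7}. core v = c}" and ?E = "\<lambda>c. {e \<in> edges Q_1_7. core ` e = {c}}"
    have "planar (?V 1 \<union> ?V 7, insert {1, 7} (?E 1 \<union> ?E 7))"
      by (rule planar_cosets_of_1_and_7) (use sub in blast)+
    moreover have "{v \<in> {1..7}. f v = i} = ?V 1 \<union> ?V 7"
      using True by (auto simp: f_def)
    moreover have "{e \<in> edges Q_1_7. f ` e = {i}} = insert {1, 7} (?E 1 \<union> ?E 7)"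
    proof (intro equalityI subsetI)
      fix e assume "e \<in> {e \<in> edges Q_1_7. f ` e = {i}}"
      then have e: "e \<in> edges Q_1_7" "f ` e = {i}" by auto
      show "e \<in> insert {1, 7} (?E 1 \<union> ?E 7)"
        using split[OF e(1)]
      proof
        assume "\<exists>c. core ` e = {c}"
        then obtain c where c: "core ` e = {c}" by blast
        then obtain v where v: "v \<in> e" "core v = c" by blast
        then have "f v = 1" using e(2) True by blast
        then have "c = 1 \<or> c = 7" using v by (auto simp: f_def split: if_splits)
        then show ?thesis using c e(1) by blast
      qed simp
    next
      fix e assume "e \<in> insert {1, 7} (?E 1 \<union> ?E 7)"
      then consider "e = {1, 7}" | "e \<in> ?E 1" | "e \<in> ?E 7" by blast
      then show "e \<in> {e \<in> edges Q_1_7. f ` e = {i}}"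
      proof cases
        case 1
        have "rat_div_adjacent 1 7"
          unfolding rat_div_adjacent_def by (auto intro!: exI[of _ "7::nat"])
        then have "{1, 7} \<in> edges Q_1_7"
          unfolding rat_div_graph_def snd_conv by force
        then show ?thesis using 1 True by (simp add: f_def core_small_numerals)
      next
        case 2
        then show ?thesis using f_image[of e 1] True by simp
      next
        case 3
        then show ?thesis using f_image[of e 7] True by simp
      qed
    qed
    ultimately show ?thesis
      by (simp add: fibre_def rat_div_graph_def)
  qed
qed

lemma colorable_Q_1_7: "colorable 3 Q_1_7"
proof -
  define c :: "rat \<Rightarrow> nat" where "c = (\<lambda>q. if q < 2 then 0 else if q < 4 then 1 else 2)"
  have double: "c x \<noteq> c y" if "2 * x \<le> y" "1 \<le> x" "y \<le> 7" for x y
    using that by (auto simp: c_def)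
  have "c u \<noteq> c v" if "{u, v} \<in> edges Q_1_7" for u v
  proof -
    from that obtain x n where xn: "{u, v} = {x, of_nat n * x}" "1 \<le> x" "2 \<le> n" "of_nat n * x \<le> 7"
      by (rule divisor_edgeE)
    have "of_nat 2 \<le> (of_nat n :: rat)" using xn(3) by (simp only: of_nat_le_iff)
    then have "2 * x \<le> of_nat n * x" using xn(2) by (intro mult_right_mono) auto
    then have "c x \<noteq> c (of_nat n * x)" by (rule double) (use xn(2,4) in auto)
    then show ?thesis using xn(1) by (metis doubleton_eq_iff)
  qed
  moreover have "c ` verts Q_1_7 \<subseteq> {..<3}" by (auto simp: c_def)
  ultimately show ?thesis unfolding colorable_def by blast
qed

theorem theorem2p3:
  "planar (rat_div_graph {1..7}) \<and> colorable 3 (rat_div_graph {1..7})"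
  using planar_Q_1_7 colorable_Q_1_7 by blast

end
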